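(* Let $n=2k$ with $k>1$ and $4\nmid k$. Let $\alpha$ be a primitive element of $\mathbb{F}_{3^n}$ and $I$ a primitive $4$th root of unity in $\mathbb{F}_{3^n}$. If $k$ is odd let $a_1=a_3=1$ and $a_2=\pm I$; if $k$ is even let $a_1=\alpha^{3^k+2}$, $a_3=\alpha$ and $a_2=\pm I a_1^{-(3^k-3)/2}$ $(=\mp I a_3^{(3^k+5)/2})$, the sign being arbitrary. Then $f:\mathbb{F}_{3^n}\to\mathbb{F}_3$, $$f(x)=\operatorname{Tr}_n\big(a_1x^{2\cdot 3^k+4}+a_2x^{3^k+5}+a_3x^2\big),$$ is a regular bent function of algebraic degree four belonging to the completed Maiorana–McFarland class.
   Context: $\operatorname{Tr}_n(x)=\sum_{i=0}^{n-1}x^{3^i}$. With $\omega=e^{2\pi i/3}$, $S_f(b)=\sum_{x\in\mathbb{F}_{3^n}}\omega^{f(x)-\operatorname{Tr}_n(bx)}$; $f$ is bent if $|S_f(b)|^2=3^n$ for all $b$, and regular bent if for all $b$, $3^{-n/2}S_f(b)=\omega^{f^*(b)}$ for some $f^*(b)\in\mathbb{F}_3$. Algebraic degree: maximal ternary digit sum of an exponent occurring. EA-equivalence: $g=a\,(f\circ L)+l$ with $L$ affine permutation, $l$ affine, $a\in\mathbb{F}_3^*$; completed class = smallest union of EA-equivalence classes containing the class. Maiorana–McFarland class: functions $f(x,y)=x\cdot\pi(y)+g(y)$ on $\mathbb{F}_3^k\times\mathbb{F}_3^k$, $\pi$ a permutation, $g$ arbitrary, with $\mathbb{F}_{3^n}$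 identified with $\mathbb{F}_3^k\times\mathbb{F}_3^k$ by an $\mathbb{F}_3$-linear isomorphism. *)

theory Defs
  imports
    Complex_Main
    "HOL-Library.Cardinality"
    "HOL-Computational_Algebra.Polynomial"
    "Jordan_Normal_Form.Matrix"
begin

text \<open>
  The field with $3^n$ elements is a type \<open>'a :: {field, finite}\<close> with \<open>CARD('a) = 3 ^ n\<close>,
  and $\mathbb{F}_3$ is its prime subfield.  A function into $\mathbb{F}_3$ is a function
  \<open>'a \<Rightarrow> 'a\<close> with values in that subfield.
\<close>

definition F3 :: "'a::field set" where
  "F3 = {0, 1, 2}"

definition ternary_functions :: "('a::field \<Rightarrow> 'a) set" where
  "ternary_functions = {f. range f \<subseteq> F3}"

definition primitive_element :: "'a::field \<Rightarrow> bool" where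
  "primitive_element \<alpha> \<longleftrightarrow> range (\<lambda>i::nat. \<alpha> ^ i) = UNIV - {0}"

definition primitive_root_of_unity :: "nat \<Rightarrow> 'a::field \<Rightarrow> bool" where
  "primitive_root_of_unity m z \<longleftrightarrow> z ^ m = 1 \<and> (\<forall>j. 0 < j \<and> j < m \<longrightarrow> z ^ j \<noteq> 1)"

definition Tr :: "nat \<Rightarrow> 'a::field \<Rightarrow> 'a" where
  "Tr n x = (\<Sum>i<n. x ^ (3 ^ i))"


subsection \<open>Walsh transform and bent functions\<close>

definition \<omega> :: complex where
  "\<omega> = exp (2 * complex_of_real pi * \<i> / 3)"

text \<open>\<open>omega_pow c\<close> is $\omega^c$ for $c \in \mathbb{F}_3$, well defined because $\omega^3 = 1$;
  it is only used for \<open>c \<in> F3\<close> in characteristic 3.\<close>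

definition omega_pow :: "'a::field \<Rightarrow> complex" where
  "omega_pow c = \<omega> ^ (THE j::nat. j < 3 \<and> of_nat j = c)"

definition walsh :: "nat \<Rightarrow> ('a::{field,finite} \<Rightarrow> 'a) \<Rightarrow> 'a \<Rightarrow> complex" where
  "walsh n f b = (\<Sum>x\<in>UNIV. omega_pow (f x - Tr n (b * x)))"

definition bent :: "nat \<Rightarrow> ('a::{field,finite} \<Rightarrow> 'a) \<Rightarrow> bool" where
  "bent n f \<longleftrightarrow> f \<in> ternary_functions \<and> (\<forall>b. (cmod (walsh n f b))\<^sup>2 = 3 ^ n)"

definition regular_bent :: "nat \<Rightarrow> ('a::{field,finite} \<Rightarrow> 'a) \<Rightarrow> bool" where
  "regular_bent n f \<longleftrightarrow> bent n f \<and>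
     (\<forall>b. \<exists>c\<in>F3. complex_of_real (3 powr (- (real n / 2))) * walsh n f b = omega_pow (c::'a))"


subsection \<open>Algebraic degree\<close>

fun ternary_digit_sum :: "nat \<Rightarrow> nat" where
  "ternary_digit_sum e = (if e = 0 then 0 else e mod 3 + ternary_digit_sum (e div 3))"

declare ternary_digit_sum.simps [simp del]

text \<open>The exponents occurring in a function are those of its univariate representation, the
  unique polynomial of degree less than the field size that induces it.  The zero function gets
  algebraic degree 0.\<close>

definition univariate_rep :: "('a::{field,finite} \<Rightarrow> 'a) \<Rightarrow> 'a poly" where
  "univariate_rep f = (THE p. degree p < CARD('a) \<and> (\<forall>x. poly p x = f x))"

definition algebraic_degree :: "('a::{field,finite} \<Rightarrow> 'a) \<Rightarrow> nat" where
  "algebraic_degree f =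
     Max (insert 0 (ternary_digit_sum ` {e. coeff (univariate_rep f) e \<noteq> 0}))"


subsection \<open>EA-equivalence and completed classes\<close>

definition F3_linear :: "('a::field \<Rightarrow> 'a) \<Rightarrow> bool" where
  "F3_linear A \<longleftrightarrow> (\<forall>x y. A (x + y) = A x + A y) \<and> (\<forall>c\<in>F3. \<forall>x. A (c * x) = c * A x)"

definition F3_affine :: "('a::field \<Rightarrow> 'a) \<Rightarrow> bool" where
  "F3_affine L \<longleftrightarrow> (\<exists>A c. F3_linear A \<and> L = (\<lambda>x. A x + c))"

definition EA_rel :: "(('a::field \<Rightarrow> 'a) \<times> ('a \<Rightarrow> 'a)) set" where
  "EA_rel = {(f, g). f \<in> ternary_functions \<and> g \<in> ternary_functions \<and>
     (\<exists>a\<in>F3 - {0}. \<exists>L l. F3_affine L \<and> bij L \<and> F3_affine l \<and> l \<in> ternary_functions \<and>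
        g = (\<lambda>x. a * f (L x) + l x))}"

text \<open>The smallest union of EA-equivalence classes containing \<open>C\<close> is the union of those
  equivalence classes that meet \<open>C\<close>.\<close>

definition completed_class :: "('a::field \<Rightarrow> 'a) set \<Rightarrow> ('a \<Rightarrow> 'a) set" where
  "completed_class C = \<Union>{E \<in> ternary_functions // EA_rel. E \<inter> C \<noteq> {}}"


subsection \<open>The Maiorana--McFarland class\<close>

definition F3_vecs :: "nat \<Rightarrow> 'a::field vec set" where
  "F3_vecs k = {v \<in> carrier_vec k. \<forall>i<k. v $ i \<in> F3}"

definition F3_pair_iso :: "nat \<Rightarrow> ('a::field vec \<times> 'a vec \<Rightarrow> 'a) \<Rightarrow> bool" where
  "F3_pair_iso k \<phi> \<longleftrightarrow>
     bij_betw \<phi> (F3_vecs k \<times> F3_vecs k) UNIV \<and>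
     (\<forall>x\<in>F3_vecs k. \<forall>y\<in>F3_vecs k. \<forall>x'\<in>F3_vecs k. \<forall>y'\<in>F3_vecs k.
        \<phi> (x + x', y + y') = \<phi> (x, y) + \<phi> (x', y')) \<and>
     (\<forall>c\<in>F3. \<forall>x\<in>F3_vecs k. \<forall>y\<in>F3_vecs k. \<phi> (c \<cdot>\<^sub>v x, c \<cdot>\<^sub>v y) = c * \<phi> (x, y))"

definition maiorana_mcfarland :: "nat \<Rightarrow> ('a::field \<Rightarrow> 'a) set" where
  "maiorana_mcfarland k = {f. \<exists>\<phi> \<pi> g. F3_pair_iso k \<phi> \<and>
     bij_betw \<pi> (F3_vecs k) (F3_vecs k) \<and> g ` F3_vecs k \<subseteq> F3 \<and>
     (\<forall>x\<in>F3_vecs k. \<forall>y\<in>F3_vecs k. f (\<phi> (x, y)) = x \<bullet> \<pi> y + g y)}"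

end

theory Submission
  imports Defs
begin

text \<open>
  Put $q = 3^k$ and $a = a_3$.  In both cases there is $c$ with $c^{q+1} = 1$ and
  $c^2 = -a^{q-1}$ such that $a_1 = a^{q+2}$ and $a_2 = c a^3$.  The elements
  $u = x + c x^q$ and $v = x - c x^q$ range over the eigenspaces $U$ and $V$ of the map
  $x \mapsto x^q$ for $c^{-1}$ and $-c^{-1}$, and $x = -(u + v)$ in characteristic 3.  Writing
  $z$ for the argument of the trace, one finds $z + z^q = a^3 u^5 v - (a u v)^3 + a u v$, and
  since $2 = -1$ this gives $f(x) = -\mathrm{Tr}_n(a^3 u^5 v)$.  As $4 \nmid k$ means
  $\gcd(5, q - 1) = 1$, the map $u \mapsto a^3 u^5$ is a bijection from $U$ onto the eigenspace $W$
  for $-c$, which the trace form pairs perfectly with $V$.  So $f$ is linear in $v$ with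
  coefficient a permutation of $u$.
\<close>

subsection \<open>Finite fields of characteristic three\<close>

text \<open>Translation by 1 permutes the ring, so the sum of all elements is unchanged when 1 is
  added \<open>CARD('a)\<close> times.\<close>

lemma of_nat_card_eq_0: "of_nat CARD('a) = (0 :: 'a::{ring_1,finite})"
proof -
  have "(\<Sum>x\<in>UNIV. x) = (\<Sum>x\<in>UNIV. x + 1 :: 'a)"
    by (rule sum.reindex_bij_witness[of _ "\<lambda>x. x + 1" "\<lambda>x. x - 1"]) auto
  then show ?thesis
    by (simp add: sum.distrib)
qed

lemma three_eq_0:
  assumes "CARD('a::{field,finite}) = 3 ^ n"
  shows "(3 :: 'a) = 0"
proof -
  have "(3 :: 'a) ^ n = 0"
    using of_nat_card_eq_0[where 'a='a] assms by simp
  then show ?thesis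
    by simp
qed

text \<open>Multiplication by a nonzero \<open>x\<close> permutes the nonzero elements; comparing
  the products of all of them gives exponent \<open>CARD('a) - 1\<close>.\<close>

lemma power_card_eq_same:
  fixes x :: "'a::{field,finite}"
  shows "x ^ CARD('a) = x"
proof (cases "x = 0")
  case False
  have "(\<Prod>y\<in>UNIV - {0}. y) = (\<Prod>y\<in>UNIV - {0}. x * y)"
    by (rule prod.reindex_bij_witness[of _ "\<lambda>y. x * y" "\<lambda>y. y / x"]) (use False in auto)
  also have "\<dots> = x ^ (CARD('a) - 1) * (\<Prod>y\<in>UNIV - {0}. y)"
    by (simp add: prod.distrib)
  finally have "x ^ (CARD('a) - 1) = 1"
    by simp
  then have "x * x ^ (CARD('a) - 1) = x"
    by simp
  then show ?thesis
    by (metis Suc_diff_1 power_Suc zero_less_card_finite)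
qed (simp add: zero_power)

context
  assumes char3: "(3 :: 'a::field) = 0"
begin

lemma two_eq_minus_one: "(2 :: 'a) = -1"
  using char3 by (simp add: eq_neg_iff_add_eq_0)

lemma one_neq_minus_one: "(1 :: 'a) \<noteq> -1"
proof
  assume "(1 :: 'a) = -1"
  then have "(1 :: 'a) + 1 = 1 + 0"
    using two_eq_minus_one by simp
  then show False
    unfolding add_left_cancel by simp
qed

lemma frobenius_add: "(x + y :: 'a) ^ 3 ^ m = x ^ 3 ^ m + y ^ 3 ^ m"
proof (induction m)
  case (Suc m)
  have cube: "(u + v) ^ 3 = u ^ 3 + v ^ 3" for u v :: 'a
  proof -
    have "(u + v) ^ 3 = u ^ 3 + v ^ 3 + 3 * (u ^ 2 * v + u * v ^ 2)"
      by (simp add: algebra_simps power2_eq_square power3_eq_cube)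
    then show ?thesis
      by (simp add: char3)
  qed
  show ?case
    using Suc by (simp add: power_mult cube mult.commute[of 3])
qed simp

lemma frobenius_minus: "(- x :: 'a) ^ 3 ^ m = - (x ^ 3 ^ m)"
  by (simp add: power_minus_odd)

lemma frobenius_diff: "(x - y :: 'a) ^ 3 ^ m = x ^ 3 ^ m - y ^ 3 ^ m"
  using frobenius_add[of x "- y"] by (simp add: frobenius_minus)

lemma frobenius_sum: "(sum g A :: 'a) ^ 3 ^ m = (\<Sum>i\<in>A. g i ^ 3 ^ m)"
  by (induction A rule: infinite_finite_induct) (auto simp: frobenius_add zero_power)

text \<open>\<open>F3\<close> is the root set of X^3 - X = X (X - 1) (X + 1). Membership thus
  becomes a Frobenius identity, from which the closure properties and the range of the trace
  follow.\<close>

lemma F3_iff: "(x :: 'a) \<in> F3 \<longleftrightarrow> x ^ 3 = x"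
proof
  assume "x ^ 3 = x"
  then have "x * (x - 1) * (x + 1) = 0"
    by (simp add: algebra_simps power3_eq_cube)
  then show "x \<in> F3"
    by (auto simp: F3_def two_eq_minus_one eq_neg_iff_add_eq_0)
next
  assume "x \<in> F3"
  then show "x ^ 3 = x"
    by (auto simp: F3_def two_eq_minus_one)
qed

lemma F3_frobenius:
  assumes "(c :: 'a) \<in> F3"
  shows "c ^ 3 ^ m = c"
  by (induction m) (use assms in \<open>auto simp: power_mult F3_iff\<close>)

lemma F3_add: "(x :: 'a) \<in> F3 \<Longrightarrow> y \<in> F3 \<Longrightarrow> x + y \<in> F3"
  using frobenius_add[of x y 1] by (simp add: F3_iff)

lemma F3_minus: "(x :: 'a) \<in> F3 \<Longrightarrow> - x \<in> F3"
  by (simp add: F3_iff)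

lemma F3_diff: "(x :: 'a) \<in> F3 \<Longrightarrow> y \<in> F3 \<Longrightarrow> x - y \<in> F3"
  using F3_add[of x "- y"] F3_minus[of y] by simp

lemma F3_mult: "(x :: 'a) \<in> F3 \<Longrightarrow> y \<in> F3 \<Longrightarrow> x * y \<in> F3"
  by (simp add: F3_iff power_mult_distrib)

lemma card_F3: "card (F3 :: 'a set) = 3"
  using one_neq_minus_one by (simp add: F3_def two_eq_minus_one)

section \<open>The trace onto the prime field\<close>

lemma Tr_add: "Tr n (x + y :: 'a) = Tr n x + Tr n y"
  by (simp add: Tr_def frobenius_add sum.distrib)

lemma Tr_minus: "Tr n (- x :: 'a) = - Tr n x"
  by (simp add: Tr_def frobenius_minus sum_negf)

lemma Tr_diff: "Tr n (x - y :: 'a) = Tr n x - Tr n y"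
  by (simp add: Tr_def frobenius_diff sum_subtractf)

lemma Tr_smult: "(c :: 'a) \<in> F3 \<Longrightarrow> Tr n (c * x) = c * Tr n x"
  by (simp add: Tr_def power_mult_distrib F3_frobenius sum_distrib_left)

lemma Tr_sum: "Tr n (sum g A :: 'a) = (\<Sum>i\<in>A. Tr n (g i))"
  by (simp add: Tr_def frobenius_sum sum.swap[of _ A])

end

lemma Tr_0 [simp]: "Tr n 0 = 0"
  by (simp add: Tr_def zero_power)

context
  fixes n :: nat
  assumes card: "CARD('a::{field,finite}) = 3 ^ n"
begin

lemma frobenius_period: "(x :: 'a) ^ 3 ^ n = x"
  using power_card_eq_same[of x] by (simp add: card)

lemma frobenius_mod: "(x :: 'a) ^ 3 ^ m = x ^ 3 ^ (m mod n)"
proof -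
  have period: "x ^ 3 ^ (n * j) = x" for x :: 'a and j
    by (induction j) (auto simp: power_add power_mult frobenius_period)
  have "x ^ 3 ^ m = x ^ 3 ^ (n * (m div n) + m mod n)"
    by simp
  also have "\<dots> = x ^ 3 ^ (m mod n)"
    by (simp only: power_add power_mult[of x] period)
  finally show ?thesis .
qed

lemma Tr_cube: "Tr n ((x :: 'a) ^ 3) = Tr n x"
proof -
  \<comment> \<open>Cubing shifts the summands by one place; the new top term x^(3^n) is
    \<open>x\<close> again.\<close>
  have "Tr n (x ^ 3) + x = (\<Sum>i<Suc n. x ^ 3 ^ i)"
    by (simp add: Tr_def sum.lessThan_Suc_shift power_mult del: sum.lessThan_Suc)
  also have "\<dots> = Tr n x + x"
    by (simp add: Tr_def frobenius_period)
  finally show ?thesis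
    by simp
qed

lemma Tr_frobenius: "Tr n ((x :: 'a) ^ 3 ^ m) = Tr n x"
  by (induction m) (auto simp: power_mult mult.commute[of 3] Tr_cube)

lemma Tr_in_F3: "Tr n (x :: 'a) \<in> F3"
proof -
  note char3 = three_eq_0[OF card]
  have "Tr n x ^ 3 = Tr n (x ^ 3)"
    using frobenius_sum[OF char3, of "\<lambda>i. x ^ 3 ^ i" "{..<n}" 1]
    by (simp add: Tr_def mult.commute flip: power_mult)
  then show ?thesis
    by (simp add: F3_iff[OF char3] Tr_cube)
qed

text \<open>For nonzero \<open>w\<close> the products \<open>w * x\<close> exhaust the field, so
  every element would be a root of the trace polynomial. That polynomial is nonzero, having
  coefficient 1 at X, and its degree is below the field size.\<close>

lemma Tr_nondegenerate:
  assumes w: "\<And>x. Tr n (w * x :: 'a) = 0"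
  shows "w = 0"
proof (rule ccontr)
  assume "w \<noteq> 0"
  \<comment> \<open>The bound 3^(n-1) < 3^n on naturals fails at n = 0; this case is excluded
    because 0 and 1 are distinct.\<close>
  have "n > 0"
  proof (rule ccontr)
    assume "\<not> n > 0"
    then have "CARD('a) \<le> 1"
      using card by simp
    moreover have "card {0, 1 :: 'a} \<le> CARD('a)"
      by (rule card_mono) auto
    ultimately show False
      by simp
  qed
  define p :: "'a poly" where "p = (\<Sum>i<n. monom 1 (3 ^ i))"
  have deg: "degree p \<le> 3 ^ (n - 1)"
    unfolding p_def
    by (intro degree_sum_le order.trans[OF degree_monom_le]) (auto intro!: power_increasing)
  have "coeff p 1 = (\<Sum>i<n. if i = 0 then 1 else 0)"
    unfolding p_def coeff_sum coeff_monom by (intro sum.cong) auto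
  then have "p \<noteq> 0"
    using \<open>n > 0\<close> by auto
  have "poly p x = 0" for x
    using w[of "x / w"] \<open>w \<noteq> 0\<close> by (simp add: p_def poly_sum poly_monom Tr_def)
  then have "CARD('a) \<le> degree p"
    using card_poly_roots_bound[OF \<open>p \<noteq> 0\<close>] by simp
  then have "3 ^ n \<le> (3 :: nat) ^ (n - 1)"
    using deg card by linarith
  then show False
    using \<open>n > 0\<close> by simp
qed

end

subsection \<open>Cubic characters\<close>

lemma omega_cube: "\<omega> ^ 3 = 1"
  by (simp add: \<omega>_def exp_two_pi_i mult_ac flip: exp_of_nat_mult)

lemma omega_neq_1: "\<omega> \<noteq> 1"
proof
  assume "\<omega> = 1"
  then have "cos (2 * pi / 3) = 1"
    by (simp add: \<omega>_def exp_eq_polar complex_eq_iff flip: cis_conv_exp)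
  then show False
    by (simp add: cos_120)
qed

lemma norm_omega: "cmod \<omega> = 1"
  by (simp add: \<omega>_def)

context
  assumes char3: "(3 :: 'a::field) = 0"
begin

text \<open>In characteristic 3 the unique choice in \<open>omega_pow\<close> is
  \<open>j mod 3\<close>, and \<omega>^3 = 1 removes the reduction. Computations with
  \<open>omega_pow\<close> become computations with ordinary powers.\<close>

lemma omega_pow_of_nat: "omega_pow (of_nat j :: 'a) = \<omega> ^ j"
proof -
  have split: "of_nat i = (of_nat (i mod 3) :: 'a)" for i
  proof -
    have "of_nat i = (of_nat (3 * (i div 3) + i mod 3) :: 'a)"
      by simp
    also have "\<dots> = of_nat (i mod 3)"
      unfolding of_nat_add of_nat_mult using char3 by simp
    finally show ?thesis .
  qed
  have inj: "i = i'" if "i < 3" "i' < 3" "of_nat i = (of_nat i' :: 'a)" for i i' :: nat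
    using that one_neq_minus_one[OF char3] 
    by (auto simp: less_Suc_eq numeral_3_eq_3 two_eq_minus_one[OF char3])
  have "(THE i. i < 3 \<and> of_nat i = (of_nat j :: 'a)) = j mod 3"
    by (rule the_equality) (use split[of j] inj in auto)
  moreover have "\<omega> ^ j = \<omega> ^ (3 * (j div 3) + j mod 3)"
    by simp
  then have "\<omega> ^ j = \<omega> ^ (j mod 3)"
    unfolding power_add power_mult omega_cube by simp
  ultimately show ?thesis
    by (simp add: omega_pow_def)
qed

lemma F3_of_nat: "(c :: 'a) \<in> F3 \<Longrightarrow> \<exists>j<3. c = of_nat j"
  unfolding F3_def by (auto intro: exI[of _ 0] exI[of _ 1] exI[of _ 2])

lemma omega_pow_add: "(c :: 'a) \<in> F3 \<Longrightarrow> d \<in> F3 \<Longrightarrow> omega_pow (c + d) = omega_pow c * omega_pow d"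
  using F3_of_nat[of c] F3_of_nat[of d]
  by (auto simp: omega_pow_of_nat power_add simp flip: of_nat_add)

lemma omega_pow_0: "omega_pow (0 :: 'a) = 1"
  using omega_pow_of_nat[of 0] by simp

lemma norm_omega_pow: "(c :: 'a) \<in> F3 \<Longrightarrow> cmod (omega_pow c) = 1"
  using F3_of_nat[of c] by (auto simp: omega_pow_of_nat norm_power norm_omega)

lemma omega_pow_neq_1:
  assumes "(c :: 'a) \<in> F3" "c \<noteq> 0"
  shows "omega_pow c \<noteq> 1"
proof -
  have "\<omega> \<^sup>2 \<noteq> 1"
    using omega_cube omega_neq_1 by (auto simp: power3_eq_cube power2_eq_square)
  moreover have "c = of_nat 1 \<or> c = of_nat 2"
    using assms by (simp add: F3_def)
  ultimately show ?thesis
    using omega_neq_1 by (auto simp only: omega_pow_of_nat power_one_right)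
qed

text \<open>Orthogonality of characters: translating the summation variable by \<open>v\<close>
  multiplies the sum by \<open>omega_pow (h v)\<close>, which is not 1.\<close>

lemma character_sum_eq_0:
  fixes h :: "'b::ab_group_add \<Rightarrow> 'a"
  assumes V: "\<And>x y. x \<in> V \<Longrightarrow> y \<in> V \<Longrightarrow> x + y \<in> V" "\<And>x. x \<in> V \<Longrightarrow> - x \<in> V"
    and h: "\<And>x y. x \<in> V \<Longrightarrow> y \<in> V \<Longrightarrow> h (x + y) = h x + h y" "h ` V \<subseteq> F3"
    and v: "v \<in> V" "h v \<noteq> 0"
  shows "(\<Sum>x\<in>V. omega_pow (h x)) = 0"
proof -
  have "(\<Sum>x\<in>V. omega_pow (h x)) = (\<Sum>x\<in>V. omega_pow (h (v + x)))"
    by (rule sum.reindex_bij_witness[of _ "\<lambda>x. v + x" "\<lambda>x. - v + x"])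
      (use V v in \<open>auto simp del: uminus_add_conv_diff\<close>)
  also have "\<dots> = omega_pow (h v) * (\<Sum>x\<in>V. omega_pow (h x))"
    using h v by (auto simp: omega_pow_add image_subset_iff sum_distrib_left intro!: sum.cong)
  finally show ?thesis
    using omega_pow_neq_1[of "h v"] h v by (auto simp: image_subset_iff)
qed

end

subsection \<open>Bases over the prime field\<close>

definition F3_comb :: "nat \<Rightarrow> (nat \<Rightarrow> 'a::field) \<Rightarrow> 'a vec \<Rightarrow> 'a" where
  "F3_comb m v x = (\<Sum>i<m. x $ i * v i)"

lemma F3_comb_add:
  "x \<in> F3_vecs m \<Longrightarrow> y \<in> F3_vecs m \<Longrightarrow> F3_comb m v (x + y) = F3_comb m v x + F3_comb m v y"
  by (auto simp: F3_comb_def F3_vecs_def algebra_simps sum.distrib intro!: sum.cong)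

lemma F3_comb_smult:
  "x \<in> F3_vecs m \<Longrightarrow> F3_comb m v (c \<cdot>\<^sub>v x) = c * F3_comb m v x"
  by (auto simp: F3_comb_def F3_vecs_def algebra_simps sum_distrib_left intro!: sum.cong)

lemma finite_F3_vecs: "finite (F3_vecs m :: 'a::field vec set)"
  and card_F3_vecs: "(3 :: 'a) = 0 \<Longrightarrow> card (F3_vecs m :: 'a vec set) = 3 ^ m"
proof -
  have bij: "bij_betw (vec m) ({..<m} \<rightarrow>\<^sub>E F3) (F3_vecs m :: 'a vec set)"
  proof (rule bij_betwI')
    fix g h :: "nat \<Rightarrow> 'a"
    assume gh: "g \<in> {..<m} \<rightarrow>\<^sub>E F3" "h \<in> {..<m} \<rightarrow>\<^sub>E F3"
    show "(vec m g = vec m h) = (g = h)"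
    proof
      assume eq: "vec m g = vec m h"
      have "g i = h i" if "i < m" for i
        using arg_cong[OF eq, of "\<lambda>x. x $ i"] that by simp
      then show "g = h"
        using gh by (intro PiE_ext) auto
    qed simp
  next
    fix x :: "'a vec"
    assume "x \<in> F3_vecs m"
    then have "x = vec m (restrict (($) x) {..<m})" "restrict (($) x) {..<m} \<in> {..<m} \<rightarrow>\<^sub>E F3"
      by (auto simp: F3_vecs_def)
    then show "\<exists>g\<in>{..<m} \<rightarrow>\<^sub>E F3. x = vec m g"
      by blast
  qed (auto simp: F3_vecs_def PiE_def Pi_def)
  have fin: "finite ({..<m} \<rightarrow>\<^sub>E (F3 :: 'a set))"
    by (intro finite_PiE) (auto simp: F3_def)
  then show "finite (F3_vecs m :: 'a vec set)"
    using bij bij_betw_finite by blast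
  show "card (F3_vecs m :: 'a vec set) = 3 ^ m" if "(3 :: 'a) = 0"
    using bij_betw_same_card[OF bij] card_F3[OF that] by (simp add: card_PiE)
qed

context
  assumes char3: "(3 :: 'a::field) = 0"
begin

lemma F3_inverse: "(c :: 'a) \<in> F3 \<Longrightarrow> c \<noteq> 0 \<Longrightarrow> c * c = 1"
  by (auto simp: F3_def two_eq_minus_one[OF char3])

text \<open>The scalars are 0, 1 and 2, so closure under addition already yields closure under
  scalar multiplication.\<close>

lemma F3_comb_in_subgroup:
  fixes V :: "'a set"
  assumes "0 \<in> V" "\<And>x y. x \<in> V \<Longrightarrow> y \<in> V \<Longrightarrow> x + y \<in> V"
    and v: "\<And>i. i < m \<Longrightarrow> v i \<in> V" and x: "x \<in> F3_vecs m"
  shows "F3_comb m v x \<in> V"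
proof -
  have smult: "c * w \<in> V" if "c \<in> F3" "w \<in> V" for c w
    using that assms(1) assms(2)[of w w] by (auto simp: F3_def simp flip: mult_2)
  have sum: "sum g A \<in> V" if "\<And>i. i \<in> A \<Longrightarrow> g i \<in> V" for g and A :: "nat set"
    using that by (induction A rule: infinite_finite_induct) (auto simp: assms(1,2))
  show ?thesis
    unfolding F3_comb_def using v x by (intro sum smult) (auto simp: F3_vecs_def)
qed

text \<open>If two combinations agreed with different coefficients of \<open>w\<close>, one could
  solve for \<open>w\<close> and place it in the span of the earlier vectors.\<close>

lemma inj_on_F3_comb_extend:
  fixes v :: "nat \<Rightarrow> 'a"
  assumes inj: "inj_on (F3_comb m v) (F3_vecs m)" and w: "w \<notin> F3_comb m v ` F3_vecs m"
  shows "inj_on (F3_comb (Suc m) (v(m := w))) (F3_vecs (Suc m))"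
proof (rule inj_onI)
  fix x y :: "'a vec"
  assume xy: "x \<in> F3_vecs (Suc m)" "y \<in> F3_vecs (Suc m)"
    and eq: "F3_comb (Suc m) (v(m := w)) x = F3_comb (Suc m) (v(m := w)) y"
  \<comment> \<open>The truncations of \<open>x\<close> and \<open>y\<close> to their first
    \<open>m\<close> coordinates.\<close>
  define x' y' where "x' = vec m (($) x)" and "y' = vec m (($) y)"
  have x'y': "x' \<in> F3_vecs m" "y' \<in> F3_vecs m"
    using xy by (auto simp: x'_def y'_def F3_vecs_def)
  have comb: "F3_comb m v (vec m (($) z)) = F3_comb m v z" for z
    by (simp add: F3_comb_def)
  have eq': "F3_comb m v x' + x $ m * w = F3_comb m v y' + y $ m * w"
    using eq unfolding x'_def y'_def comb by (simp add: F3_comb_def)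
  define d where "d = x $ m - y $ m"
  have coord: "x $ m \<in> F3" "y $ m \<in> F3"
    using xy by (auto simp: F3_vecs_def)
  then have d: "d \<in> F3"
    by (simp add: d_def F3_diff[OF char3])
  have "d = 0"
  proof (rule ccontr)
    assume "d \<noteq> 0"
    \<comment> \<open>A nonzero element of \<open>F3\<close> is its own inverse, so multiplying by
      \<open>d\<close> solves for \<open>w\<close>.\<close>
    have "w = d * (d * w)"
      using F3_inverse[OF d \<open>d \<noteq> 0\<close>] by (simp flip: mult.assoc)
    also have "d * w = F3_comb m v y' - F3_comb m v x'"
      using eq' by (simp add: d_def algebra_simps)
    also have "\<dots> = F3_comb m v (y' - x')"
      using x'y' by (auto simp: F3_comb_def F3_vecs_def algebra_simps simp flip: sum_subtractf)
    also have "d * \<dots> = F3_comb m v (d \<cdot>\<^sub>v (y' - x'))"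
      using x'y' F3_diff[OF char3] by (subst F3_comb_smult) (auto simp: F3_vecs_def)
    finally have "w = F3_comb m v (d \<cdot>\<^sub>v (y' - x'))" .
    moreover have "d \<cdot>\<^sub>v (y' - x') \<in> F3_vecs m"
      using x'y' F3_diff[OF char3] F3_mult[OF char3 d] by (auto simp: F3_vecs_def)
    ultimately show False
      using w by blast
  qed
  then have last: "x $ m = y $ m"
    by (simp add: d_def)
  then have "x' = y'"
    using eq' x'y' inj by (auto dest: inj_onD)
  then have "x' $ i = y' $ i" for i
    by simp
  then have "x $ i = y $ i" if "i < m" for i
    using that by (metis x'_def y'_def index_vec)
  then show "x = y"
    using xy last by (intro eq_vecI) (auto simp: F3_vecs_def less_Suc_eq)
qed

text \<open>Basis extension by counting: a family of \<open>j\<close> independent vectors spans 3^j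
  elements, so for j < m some element of \<open>V\<close> lies outside the span and can be adjoined.
  At j = m the span has the size of \<open>V\<close>.\<close>

lemma F3_basis_exists:
  fixes V :: "'a set"
  assumes V: "0 \<in> V" "\<And>x y. x \<in> V \<Longrightarrow> y \<in> V \<Longrightarrow> x + y \<in> V" and card: "card V = 3 ^ m"
  obtains v where "\<And>i. i < m \<Longrightarrow> v i \<in> V" "bij_betw (F3_comb m v) (F3_vecs m) V"
proof -
  \<comment> \<open>\<open>P j\<close>: \<open>V\<close> contains \<open>j\<close> vectors that are
    linearly independent over \<open>F3\<close>.\<close>
  define P where "P j \<longleftrightarrow> (\<exists>v. (\<forall>i<j. v i \<in> V) \<and> inj_on (F3_comb j v) (F3_vecs j))" for j
  have fin: "finite V"
    using card by (metis card.infinite power_not_zero zero_neq_numeral)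
  have image: "F3_comb j v ` F3_vecs j \<subseteq> V" if "\<forall>i<j. v i \<in> V" for j v
    using F3_comb_in_subgroup[of V j v] V that by blast
  have le: "j \<le> m" if "P j" for j
  proof -
    obtain v where v: "\<forall>i<j. v i \<in> V" "inj_on (F3_comb j v) (F3_vecs j)"
      using \<open>P j\<close> unfolding P_def by blast
    have "card (F3_vecs j :: 'a vec set) \<le> card V"
      by (rule card_inj_on_le[OF v(2) image fin]) (use v(1) in auto)
    then show "j \<le> m"
      by (simp add: card card_F3_vecs[OF char3])
  qed
  have "P j" if "j \<le> m" for j
    using that
  proof (induction j)
    case 0
    have "F3_vecs 0 = {0\<^sub>v 0 :: 'a vec}"
      by (auto simp: F3_vecs_def)
    then show ?case
      by (simp add: P_def)
  next
    case (Suc j)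
    then obtain v where v: "\<forall>i<j. v i \<in> V" "inj_on (F3_comb j v) (F3_vecs j)"
      unfolding P_def by auto
    have "card (F3_comb j v ` F3_vecs j) = 3 ^ j"
      by (simp add: card_image[OF v(2)] card_F3_vecs[OF char3])
    moreover have "(3 :: nat) ^ j < 3 ^ m"
      using Suc.prems by simp
    ultimately have "F3_comb j v ` F3_vecs j \<noteq> V"
      using card by auto
    then obtain w where w: "w \<in> V" "w \<notin> F3_comb j v ` F3_vecs j"
      using image[OF v(1)] by blast
    have "\<forall>i<Suc j. (v(j := w)) i \<in> V"
      using v(1) w(1) by (simp add: less_Suc_eq)
    then show ?case
      unfolding P_def using inj_on_F3_comb_extend[OF v(2) w(2)] by blast
  qed
  then obtain v where v: "\<forall>i<m. v i \<in> V" "inj_on (F3_comb m v) (F3_vecs m)"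
    unfolding P_def by blast
  have "F3_comb m v ` F3_vecs m = V"
    by (rule card_subset_eq[OF fin image]) (use v in \<open>auto simp: card_image card card_F3_vecs[OF char3]\<close>)
  then show ?thesis
    using that v by (auto simp: bij_betw_def)
qed

end

subsection \<open>Ternary expansions\<close>

lemma ternary_expansion_less:
  fixes c :: "nat \<Rightarrow> nat"
  assumes c: "\<And>j. c j \<le> 2"
  shows "(\<Sum>j<n. c j * 3 ^ j) < 3 ^ n"
proof (induction n)
  case (Suc n)
  have "c n * 3 ^ n \<le> 2 * 3 ^ n"
    using c by simp
  then show ?case
    using Suc by (simp only: sum.lessThan_Suc power_Suc)
qed simp

text \<open>Splits off the lowest digit, to match the recursion of \<open>ternary_digit_sum\<close>
  through \<open>mod 3\<close> and \<open>div 3\<close>.\<close>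

lemma ternary_expansion_Suc:
  "(\<Sum>j<Suc n. c j * 3 ^ j) = c 0 + 3 * (\<Sum>j<n. c (Suc j) * 3 ^ j)" for c :: "nat \<Rightarrow> nat"
  unfolding sum.lessThan_Suc_shift by (simp add: sum_distrib_left mult_ac)

lemma ternary_digit_sum_rec: "ternary_digit_sum e = e mod 3 + ternary_digit_sum (e div 3)"
  by (cases "e = 0") (simp_all add: ternary_digit_sum.simps)

lemma ternary_digit_sum_expansion:
  assumes "\<And>j. c j \<le> 2"
  shows "ternary_digit_sum (\<Sum>j<n. c j * 3 ^ j) = (\<Sum>j<n. c j)"
  using assms
proof (induction n arbitrary: c)
  case (Suc n)
  have "c 0 < 3"
    using Suc.prems[of 0] by simp
  then show ?case
    using Suc.IH[of "\<lambda>j. c (Suc j)"] Suc.prems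
    unfolding ternary_expansion_Suc sum.lessThan_Suc_shift
    by (subst ternary_digit_sum_rec) simp
qed (simp add: ternary_digit_sum.simps)

lemma ternary_expansion_unique:
  fixes c d :: "nat \<Rightarrow> nat"
  assumes "\<And>j. c j \<le> 2" "\<And>j. d j \<le> 2"
    and "(\<Sum>j<n. c j * 3 ^ j) = (\<Sum>j<n. d j * 3 ^ j)" and "i < n"
  shows "c i = d i"
  using assms
proof (induction n arbitrary: c d i)
  case (Suc n)
  have eq: "c 0 + 3 * (\<Sum>j<n. c (Suc j) * 3 ^ j) = d 0 + 3 * (\<Sum>j<n. d (Suc j) * 3 ^ j)"
    using Suc.prems(3) unfolding ternary_expansion_Suc .
  moreover have "c 0 < 3" "d 0 < 3"
    using Suc.prems(1)[of 0] Suc.prems(2)[of 0] by simp_all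
  ultimately have "c 0 = d 0"
    by presburger
  moreover from this eq have "c (Suc j) = d (Suc j)" if "j < n" for j
    using Suc.IH[of "\<lambda>j. c (Suc j)" "\<lambda>j. d (Suc j)" j] Suc.prems that by simp
  ultimately show ?case
    using Suc.prems(4) by (cases i) auto
qed simp

section \<open>Uniqueness of the univariate representation\<close>

lemma univariate_rep_eqI:
  fixes p :: "'a::{field,finite} poly"
  assumes "degree p < CARD('a)" and "\<And>x. poly p x = f x"
  shows "univariate_rep f = p"
  unfolding univariate_rep_def
proof (rule the_equality)
  fix r :: "'a poly"
  assume "degree r < CARD('a) \<and> (\<forall>x. poly r x = f x)"
  then show "r = p"
    using assms by (intro poly_eqI_degree[of UNIV]) auto
qed (use assms in auto)

subsection \<open>The quartic function in eigenspace coordinates\<close>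

text \<open>Since 81 is 1 modulo 5, 3^k modulo 5 depends only on \<open>k mod 4\<close>; the
  residues for 1, 2, 3 are 3, 4, 2, never 1.\<close>

lemma coprime_5_power_3_minus_1:
  assumes "\<not> 4 dvd k"
  shows "coprime 5 (3 ^ k - 1 :: nat)"
proof -
  have period: "(3 :: nat) ^ (4 * j) mod 5 = 1" for j
    by (simp add: power_mult power_mod[of "81::nat", symmetric])
  have "(3 :: nat) ^ k mod 5 = (3 ^ (4 * (k div 4)) mod 5 * 3 ^ (k mod 4)) mod 5"
    by (simp add: mod_mult_left_eq flip: power_add)
  also have "\<dots> = 3 ^ (k mod 4) mod 5"
    by (simp add: period)
  finally have "(3 :: nat) ^ k mod 5 = 3 ^ (k mod 4) mod 5" .
  moreover have "k mod 4 \<in> {1, 2, 3}"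
    using assms by (auto simp: dvd_eq_mod_eq_0)
  ultimately have "(3 :: nat) ^ k mod 5 \<noteq> 1"
    by auto
  moreover have "(3 :: nat) ^ k \<ge> 1"
    by simp
  ultimately have "\<not> 5 dvd (3 :: nat) ^ k - 1"
    by presburger
  moreover have "prime (5 :: nat)"
    by simp
  ultimately show ?thesis
    by (rule prime_imp_coprime[rotated])
qed

text \<open>Bezout over the naturals: from l i = m j + 1, comparing r^(l i) with r^(m j) r leaves
  \<open>r\<close>.\<close>

lemma power_eq_1_coprime:
  fixes r :: "'a::monoid_mult"
  assumes "r ^ l = 1" "r ^ m = 1" "coprime l m" "l \<noteq> 0"
  shows "r = 1"
proof -
  obtain i j where "l * i = m * j + 1"
    using bezout_nat[of l m] assms by auto
  then have "r ^ (l * i) = r ^ (m * j) * r"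
    by (simp add: power_add power_commutes)
  then show ?thesis
    using assms by (simp add: power_mult)
qed

section \<open>Eigenspaces of the F3-linear map x \<mapsto> x^q\<close>

definition eig :: "nat \<Rightarrow> 'a::field \<Rightarrow> 'a set" where
  "eig k e = {x. x ^ 3 ^ k = e * x}"

lemma card_eig_le:
  fixes e :: "'a::field"
  assumes "k > 0"
  shows "card (eig k e) \<le> 3 ^ k"
proof -
  define p where "p = monom 1 (3 ^ k) - monom e 1"
  have "coeff p (3 ^ k) = 1"
    \<comment> \<open>\<open>k > 0\<close> separates X^q from X, so the leading coefficient stays 1
      even for \<open>e = 1\<close>.\<close>
    using assms one_less_power[of "3 :: nat" k] by (simp add: p_def del: one_less_power)
  then have "p \<noteq> 0"
    by auto
  have "eig k e = {x. poly p x = 0}"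
    by (simp add: eig_def p_def poly_monom)
  moreover have "degree p \<le> 3 ^ k"
    unfolding p_def by (intro degree_diff_le order.trans[OF degree_monom_le]) auto
  ultimately show ?thesis
    using card_poly_roots_bound[OF \<open>p \<noteq> 0\<close>] by simp
qed

text \<open>Common form of both coefficient families, with \<open>a\<close> for a_3.
  \<open>c_norm\<close> makes x \<mapsto> c x^q an involution, whose eigenspaces for 1 and -1 are
  \<open>U\<close> and \<open>V\<close> below; \<open>c_square\<close> expresses a^q through
  \<open>a\<close> and \<open>c\<close>.\<close>

locale quartic =
  fixes n k :: nat and a c :: "'a::{field,finite}"
  assumes card: "CARD('a) = 3 ^ n" and n: "n = 2 * k" and k: "k > 0"
    and a: "a \<noteq> 0" and c_norm: "c ^ (3 ^ k + 1) = 1" and c_square: "c\<^sup>2 = - (a ^ (3 ^ k - 1))"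
begin

lemmas char3 = three_eq_0[OF card]

abbreviation "U \<equiv> eig k (inverse c)"
abbreviation "V \<equiv> eig k (- inverse c)"
abbreviation "W \<equiv> eig k (- c)"

definition quartic_fun :: "'a \<Rightarrow> 'a" where
  "quartic_fun x = Tr n (a ^ (3 ^ k + 2) * x ^ (2 * 3 ^ k + 4) + c * a ^ 3 * x ^ (3 ^ k + 5) + a * x\<^sup>2)"

lemma c_nz: "c \<noteq> 0"
  using c_norm by auto

text \<open>The suffix \<open>conj\<close> refers to x \<mapsto> x^q, an automorphism whose square
  is the identity because n = 2 k.\<close>

lemma c_conj: "c ^ 3 ^ k = inverse c"
  using c_norm c_nz by (simp add: field_simps)

lemma a_conj: "a ^ 3 ^ k = - (a * c\<^sup>2)"
proof -
  have "a ^ 3 ^ k = a ^ (Suc (3 ^ k - 1))"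
    by simp
  then show ?thesis
    by (simp only: power_Suc c_square) simp
qed

lemma conj_conj: "((x :: 'a) ^ 3 ^ k) ^ 3 ^ k = x"
  using frobenius_period[OF card, of x] by (simp add: n power_add mult_2 flip: power_mult)

lemma power_conj: "((t :: 'a) ^ j) ^ 3 ^ k = (t ^ 3 ^ k) ^ j"
  by (simp add: mult.commute flip: power_mult)

lemma inverse_conj: "(inverse (x :: 'a)) ^ 3 ^ k = inverse (x ^ 3 ^ k)"
  by (rule power_inverse)

lemmas conj_simps = frobenius_add[OF char3] frobenius_diff[OF char3] frobenius_minus[OF char3]
  power_mult_distrib inverse_conj conj_conj c_conj

lemma eig_add: "x \<in> eig k e \<Longrightarrow> y \<in> eig k e \<Longrightarrow> x + y \<in> eig k e" for x y e :: 'a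
  by (simp add: eig_def frobenius_add[OF char3] algebra_simps)

lemma eig_minus: "x \<in> eig k e \<Longrightarrow> - x \<in> eig k e" for x e :: 'a
  by (simp add: eig_def frobenius_minus[OF char3])

lemma eig_zero: "0 \<in> eig k e" for e :: 'a
  by (simp add: eig_def zero_power)

text \<open>Splitting of the field by the involution x \<mapsto> c x^q into its eigenspaces. The
  usual factor 1/2 is -1 here, whence the sign.\<close>

lemma decomposition: "bij_betw (\<lambda>(v, u). - (u + v)) (V \<times> U) UNIV"
proof (rule bij_betw_byWitness[where f' = "\<lambda>x. (x - c * x ^ 3 ^ k, x + c * x ^ 3 ^ k)"])
  have three: "- t - t = t" for t :: 'a
  proof -
    have "- t - t = t - 3 * t"
      by (simp add: algebra_simps)
    then show ?thesis
      by (simp add: char3)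
  qed
  show "\<forall>z\<in>V \<times> U. (case case z of (v, u) \<Rightarrow> - (u + v) of
      x \<Rightarrow> (x - c * x ^ 3 ^ k, x + c * x ^ 3 ^ k)) = z"
    using c_nz three by (auto simp: eig_def conj_simps algebra_simps)
  show "\<forall>x\<in>UNIV. (case (x - c * x ^ 3 ^ k, x + c * x ^ 3 ^ k) of (v, u) \<Rightarrow> - (u + v)) = x"
    using three by (simp add: algebra_simps)
  show "(\<lambda>x. (x - c * x ^ 3 ^ k, x + c * x ^ 3 ^ k)) ` UNIV \<subseteq> V \<times> U"
    using c_nz by (auto simp: eig_def conj_simps algebra_simps)
qed auto

text \<open>Each eigenspace has at most q elements as a root set, while by the decomposition the
  product of the two sizes is q^2.\<close>

lemma card_V: "card V = 3 ^ k" and card_U: "card U = 3 ^ k"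
proof -
  have prod: "card V * card U = 3 ^ k * 3 ^ k"
    using bij_betw_same_card[OF decomposition]
    by (simp add: card_cartesian_product card n mult_2 power_add)
  note le = card_eig_le[OF k, of "inverse c"] card_eig_le[OF k, of "- inverse c"]
  have "card V * card U \<le> card V * 3 ^ k" "card V * card U \<le> 3 ^ k * card U"
    using le by (auto intro: mult_le_mono)
  then have "3 ^ k \<le> card V" "3 ^ k \<le> card U"
    unfolding prod by simp_all
  then show "card V = 3 ^ k" "card U = 3 ^ k"
    using le by simp_all
qed

text \<open>The trace argument z and its conjugate have equal trace, so 2 Tr z is the trace of z +
  z^q, which simplifies in the coordinates \<open>u\<close> and \<open>v\<close>.\<close>

lemma quartic_fun_decomposition:
  assumes "u \<in> U" "v \<in> V"
  shows "quartic_fun (- (u + v)) = - Tr n (a ^ 3 * u ^ 5 * v)"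
proof -
  \<comment> \<open>\<open>w\<close> is c x^q in these coordinates; up to the factor 1/c,
    conjugation interchanges \<open>x\<close> and \<open>w\<close>.\<close>
  define x w where "x = - (u + v)" and "w = v - u"
  have x_conj: "x ^ 3 ^ k = w / c"
    using assms c_nz by (simp add: x_def w_def eig_def conj_simps field_simps)
  have w_conj: "w ^ 3 ^ k = x / c"
    using assms c_nz by (simp add: x_def w_def eig_def conj_simps field_simps)
  define z where "z = a ^ (3 ^ k + 2) * x ^ (2 * 3 ^ k + 4) + c * a ^ 3 * x ^ (3 ^ k + 5) + a * x\<^sup>2"
  have "z = a ^ 3 ^ k * a\<^sup>2 * ((x ^ 3 ^ k)\<^sup>2 * x ^ 4) + c * a ^ 3 * (x ^ 3 ^ k * x ^ 5) + a * x\<^sup>2"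
    unfolding z_def power_add by (simp add: mult.commute[of 2] power_mult)
  then have z: "z = - (a ^ 3 * w\<^sup>2 * x ^ 4) + a ^ 3 * w * x ^ 5 + a * x\<^sup>2"
    using c_nz by (simp add: x_conj a_conj field_simps power2_eq_square power3_eq_cube)
  have "z ^ 3 ^ k = a ^ 3 * w ^ 4 * x\<^sup>2 - a ^ 3 * w ^ 5 * x - a * w\<^sup>2"
  proof -
    have "z ^ 3 ^ k = - ((- (a * c\<^sup>2)) ^ 3 * (x / c)\<^sup>2 * (w / c) ^ 4)
        + (- (a * c\<^sup>2)) ^ 3 * (x / c) * (w / c) ^ 5 + - (a * c\<^sup>2) * (w / c)\<^sup>2"
      unfolding z by (simp only: frobenius_add[OF char3] frobenius_minus[OF char3]
          power_mult_distrib power_conj x_conj w_conj a_conj)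
    then show ?thesis
      using c_nz by (simp add: power_divide power_mult_distrib field_simps eval_nat_numeral)
  qed
  then have "z + z ^ 3 ^ k =
      a ^ 3 * (- (w\<^sup>2 * x ^ 4) + w * x ^ 5 + w ^ 4 * x\<^sup>2 - w ^ 5 * x) + a * (x\<^sup>2 - w\<^sup>2)"
    unfolding z by (simp add: algebra_simps)
  \<comment> \<open>The terms pair up as x w (x^4 - w^4) and x^2 w^2 (w^2 - x^2), with common factor
    x w (x^2 - w^2). In characteristic 3 the three factors then become monomials in
    \<open>u\<close>, \<open>v\<close> or u^2 - v^2.\<close>
  also have "- (w\<^sup>2 * x ^ 4) + w * x ^ 5 + w ^ 4 * x\<^sup>2 - w ^ 5 * x =
      (x * w) * (x\<^sup>2 - w\<^sup>2) * ((x\<^sup>2 + w\<^sup>2) - x * w)"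
    by (simp add: algebra_simps eval_nat_numeral)
  also have "x\<^sup>2 - w\<^sup>2 = u * v"
  proof -
    have "x\<^sup>2 - w\<^sup>2 = u * v + 3 * (u * v)"
      unfolding x_def w_def by (simp add: algebra_simps power2_eq_square)
    then show ?thesis
      by (simp add: char3)
  qed
  also have "x * w = u\<^sup>2 - v\<^sup>2"
    unfolding x_def w_def by (simp add: algebra_simps power2_eq_square)
  also have "(x\<^sup>2 + w\<^sup>2) - (u\<^sup>2 - v\<^sup>2) = u\<^sup>2"
  proof -
    have "(x\<^sup>2 + w\<^sup>2) - (u\<^sup>2 - v\<^sup>2) = u\<^sup>2 + 3 * v\<^sup>2"
      unfolding x_def w_def by (simp add: algebra_simps power2_eq_square)
    then show ?thesis
      by (simp add: char3)
  qed
  also have "a ^ 3 * ((u\<^sup>2 - v\<^sup>2) * (u * v) * u\<^sup>2) + a * (u * v) =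
      a ^ 3 * u ^ 5 * v - (a * u * v) ^ 3 + a * u * v"
    by (simp add: algebra_simps eval_nat_numeral)
  finally have "Tr n z + Tr n (z ^ 3 ^ k) = Tr n (a ^ 3 * u ^ 5 * v - (a * u * v) ^ 3 + a * u * v)"
    by (simp flip: Tr_add[OF char3])
  \<comment> \<open>The cube of \<open>a * u * v\<close> has the same trace as
    \<open>a * u * v\<close>, so these two terms cancel.\<close>
  then have "2 * Tr n z = Tr n (a ^ 3 * u ^ 5 * v)"
    by (simp add: Tr_frobenius[OF card] Tr_add[OF char3] Tr_diff[OF char3] Tr_cube[OF card])
  then have "Tr n z = - Tr n (a ^ 3 * u ^ 5 * v)"
    unfolding two_eq_minus_one[OF char3] by (metis mult_minus1 minus_minus)
  then show ?thesis
    unfolding quartic_fun_def x_def[symmetric] z_def[symmetric] .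
qed

text \<open>For \<open>w\<close> in \<open>W\<close> and \<open>u\<close> in \<open>U\<close> the
  eigenvalues multiply to -1, so Tr(w u) equals its own negative and vanishes. Thus
  \<open>w\<close>, if orthogonal to \<open>V\<close>, is orthogonal to the whole field.\<close>

lemma Tr_V_nondegenerate:
  assumes w: "w \<in> W" and V: "\<And>v. v \<in> V \<Longrightarrow> Tr n (w * v) = 0"
  shows "w = 0"
proof (rule Tr_nondegenerate[OF card])
  fix x
  have "x \<in> (\<lambda>(v, u). - (u + v)) ` (V \<times> U)"
    using bij_betw_imp_surj_on[OF decomposition] by simp
  then obtain u v where uv: "u \<in> U" "v \<in> V" and x: "x = - (u + v)"
    by (auto simp del: minus_add_distrib)
  have "(w * u) ^ 3 ^ k = - (w * u)"
    using w uv c_nz by (simp add: eig_def power_mult_distrib)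
  then have "Tr n (w * u) = - Tr n (w * u)"
    using Tr_frobenius[OF card, of "w * u" k] by (simp add: Tr_minus[OF char3])
  then have "2 * Tr n (w * u) = 0"
    by (simp add: eq_neg_iff_add_eq_0)
  then have "Tr n (w * u) = 0"
    by (simp add: two_eq_minus_one[OF char3])
  then show "Tr n (w * x) = 0"
    using V[OF uv(2)] unfolding x
    by (simp add: algebra_simps Tr_diff[OF char3] Tr_minus[OF char3])
qed

lemma Tr_V_sum:
  assumes "w \<in> W"
  shows "(\<Sum>v\<in>V. omega_pow (Tr n (w * v))) = (if w = 0 then 3 ^ k else 0)"
proof (cases "w = 0")
  case True
  then show ?thesis
    by (simp add: omega_pow_0[OF char3] card_V)
next
  case False
  then obtain v where v: "v \<in> V" "Tr n (w * v) \<noteq> 0"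
    using Tr_V_nondegenerate[OF assms] by blast
  have "(\<Sum>v\<in>V. omega_pow (Tr n (w * v))) = 0"
    by (rule character_sum_eq_0[where h = "\<lambda>v. Tr n (w * v)", OF char3 _ _ _ _ v])
      (auto simp: eig_add eig_minus algebra_simps Tr_add[OF char3] Tr_in_F3[OF card])
  then show ?thesis
    using False by simp
qed

text \<open>A quotient of nonzero elements of \<open>U\<close> is fixed by x \<mapsto> x^q, so its
  order divides q - 1; equal fifth powers make it 1 by coprimality. Surjectivity follows from |U| =
  q and |W| \<le> q.\<close>

lemma bij_fifth_power:
  assumes "\<not> 4 dvd k"
  shows "bij_betw (\<lambda>u. a ^ 3 * u ^ 5) U W"
proof -
  have inj: "inj_on (\<lambda>u. a ^ 3 * u ^ 5) U"
  proof (rule inj_onI)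
    fix u u'
    assume u: "u \<in> U" "u' \<in> U" and "a ^ 3 * u ^ 5 = a ^ 3 * u' ^ 5"
    then have eq: "u ^ 5 = u' ^ 5"
      using a by simp
    show "u = u'"
    proof (cases "u' = 0")
      case False
      then have "u \<noteq> 0"
        using eq by auto
      define r where "r = u / u'"
      have "r ^ 3 ^ k = r"
        using u c_nz by (simp add: r_def eig_def power_divide)
      then have "r * r ^ (3 ^ k - 1) = r"
        by (simp flip: power_Suc)
      then have "r ^ (3 ^ k - 1) = 1"
        using \<open>u \<noteq> 0\<close> False by (simp add: r_def)
      moreover have "r ^ 5 = 1"
        using eq False by (simp add: r_def power_divide)
      ultimately have "r = 1"
        using power_eq_1_coprime[of r 5] coprime_5_power_3_minus_1[OF assms] by simp
      then show ?thesis
        using False by (simp add: r_def)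
    qed (use eq in simp)
  qed
  have into: "(\<lambda>u. a ^ 3 * u ^ 5) ` U \<subseteq> W"
  proof safe
    fix u
    assume "u \<in> U"
    \<comment> \<open>The new eigenvalue arises as (-c^2)^3 c^(-5) = -c.\<close>
    then have "(a ^ 3 * u ^ 5) ^ 3 ^ k = (- (a * c\<^sup>2)) ^ 3 * (inverse c * u) ^ 5"
      by (simp only: eig_def mem_Collect_eq power_mult_distrib[of "a ^ 3"] power_conj a_conj)
    also have "\<dots> = - c * (a ^ 3 * u ^ 5)"
      using c_nz by (simp add: power_mult_distrib field_simps eval_nat_numeral)
    finally show "a ^ 3 * u ^ 5 \<in> W"
      by (simp add: eig_def)
  qed
  have "card ((\<lambda>u. a ^ 3 * u ^ 5) ` U) = 3 ^ k"
    using inj by (simp add: card_image card_U)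
  then have "(\<lambda>u. a ^ 3 * u ^ 5) ` U = W"
    using into card_eig_le[OF k, of "- c"] by (intro card_seteq) auto
  then show ?thesis
    using inj by (simp add: bij_betw_def)
qed

section \<open>Walsh spectrum, regular bentness and Maiorana-McFarland form\<close>

lemma quartic_fun_ternary: "quartic_fun \<in> ternary_functions"
  by (auto simp: ternary_functions_def quartic_fun_def Tr_in_F3[OF card])

text \<open>Summing over \<open>V\<close> first, the inner character sum vanishes except at the
  single \<open>u0\<close> where the coefficient of \<open>v\<close> is zero. There it equals q, and
  the surviving phase Tr(b u0) is the value of the dual function.\<close>

lemma walsh_quartic_fun:
  assumes "\<not> 4 dvd k"
  shows "\<exists>d\<in>F3. walsh n quartic_fun b = 3 ^ k * omega_pow (d :: 'a)"
proof -
  \<comment> \<open>The projection of \<open>b\<close> to \<open>W\<close> along the eigenspace for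
    \<open>c\<close>; the other component of \<open>b\<close> is orthogonal to \<open>V\<close>, so
    \<open>B\<close> and \<open>b\<close> give the same functional on \<open>V\<close>.\<close>
  define B where "B = inverse c * b ^ 3 ^ k - b"
  have B: "B \<in> W"
    using c_nz by (simp add: B_def eig_def conj_simps algebra_simps)
  have Tr_b: "Tr n (b * v) = Tr n (B * v)" if "v \<in> V" for v
  proof -
    have "Tr n (b * v) = Tr n (b ^ 3 ^ k * v ^ 3 ^ k)"
      using Tr_frobenius[OF card, of "b * v" k] by (simp add: power_mult_distrib)
    also have "\<dots> = - Tr n (inverse c * b ^ 3 ^ k * v)"
      using that by (simp add: eig_def mult_ac flip: Tr_minus[OF char3])
    finally have "Tr n (B * v) = - (2 * Tr n (b * v))"
      by (simp add: B_def left_diff_distrib Tr_diff[OF char3])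
    then show ?thesis
      by (simp add: two_eq_minus_one[OF char3])
  qed
  have bij: "bij_betw (\<lambda>u. a ^ 3 * u ^ 5) U W"
    using bij_fifth_power[OF assms] .
  have "B \<in> (\<lambda>u. a ^ 3 * u ^ 5) ` U"
    using bij_betw_imp_surj_on[OF bij] B by simp
  then obtain u0 where u0: "u0 \<in> U" "a ^ 3 * u0 ^ 5 = B"
    by auto
  have iff: "B - a ^ 3 * u ^ 5 = 0 \<longleftrightarrow> u = u0" if "u \<in> U" for u
  proof
    assume "B - a ^ 3 * u ^ 5 = 0"
    then have "a ^ 3 * u ^ 5 = a ^ 3 * u0 ^ 5"
      unfolding u0(2) by simp
    then show "u = u0"
      by (rule inj_onD[OF bij_betw_imp_inj_on[OF bij] _ that u0(1)])
  next
    assume "u = u0"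
    then show "B - a ^ 3 * u ^ 5 = 0"
      using u0(2) by simp
  qed
  have summand: "omega_pow (quartic_fun (- (u + v)) - Tr n (b * - (u + v))) =
      omega_pow (Tr n (b * u)) * omega_pow (Tr n ((B - a ^ 3 * u ^ 5) * v))"
    if "u \<in> U" "v \<in> V" for u v
  proof -
    have "quartic_fun (- (u + v)) - Tr n (b * - (u + v)) =
        Tr n (b * u) + Tr n ((B - a ^ 3 * u ^ 5) * v)"
      unfolding quartic_fun_decomposition[OF that] left_diff_distrib mult_minus_right distrib_left
        Tr_minus[OF char3] Tr_diff[OF char3] Tr_add[OF char3] Tr_b[OF that(2)]
      by simp
    then show ?thesis
      by (simp add: omega_pow_add[OF char3] Tr_in_F3[OF card])
  qed
  have "walsh n quartic_fun b =
      (\<Sum>(v, u)\<in>V \<times> U. omega_pow (quartic_fun (- (u + v)) - Tr n (b * - (u + v))))"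
    unfolding walsh_def sum.reindex_bij_betw[OF decomposition, symmetric]
    by (intro sum.cong) auto
  also have "\<dots> = (\<Sum>v\<in>V. \<Sum>u\<in>U. omega_pow (Tr n (b * u)) * omega_pow (Tr n ((B - a ^ 3 * u ^ 5) * v)))"
    unfolding sum.cartesian_product[symmetric] by (intro sum.cong refl summand)
  also have "\<dots> = (\<Sum>u\<in>U. omega_pow (Tr n (b * u)) * (\<Sum>v\<in>V. omega_pow (Tr n ((B - a ^ 3 * u ^ 5) * v))))"
    unfolding sum_distrib_left by (rule sum.swap)
  also have "\<dots> = (\<Sum>u\<in>U. if u = u0 then 3 ^ k * omega_pow (Tr n (b * u0)) else 0)"
  proof (rule sum.cong)
    fix u
    assume u: "u \<in> U"
    then have "a ^ 3 * u ^ 5 \<in> W"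
      by (rule bij_betwE[OF bij, rule_format])
    then have "B - a ^ 3 * u ^ 5 \<in> W"
      using eig_add[OF B eig_minus] by (metis diff_conv_add_uminus)
    from Tr_V_sum[OF this]
    show "omega_pow (Tr n (b * u)) * (\<Sum>v\<in>V. omega_pow (Tr n ((B - a ^ 3 * u ^ 5) * v))) =
        (if u = u0 then 3 ^ k * omega_pow (Tr n (b * u0)) else 0)"
      using iff[OF u] by auto
  qed simp
  also have "\<dots> = 3 ^ k * omega_pow (Tr n (b * u0))"
    using u0(1) by (subst sum.delta) auto
  finally show ?thesis
    using Tr_in_F3[OF card] by blast
qed

lemma regular_bent_quartic_fun:
  assumes "\<not> 4 dvd k"
  shows "regular_bent n quartic_fun"
  unfolding regular_bent_def bent_def
proof (intro conjI allI)
  fix b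
  obtain d where d: "d \<in> F3" "walsh n quartic_fun b = 3 ^ k * omega_pow (d :: 'a)"
    using walsh_quartic_fun[OF assms] by blast
  show "(cmod (walsh n quartic_fun b))\<^sup>2 = 3 ^ n"
    unfolding d(2) norm_mult norm_power norm_omega_pow[OF char3 d(1)]
    by (simp add: n mult.commute flip: power_mult)
  have "complex_of_real (3 powr - (real n / 2)) * 3 ^ k = complex_of_real (3 powr - real k * 3 powr real k)"
    by (simp add: n powr_realpow)
  also have "\<dots> = 1"
    by (simp flip: powr_add)
  finally show "\<exists>e\<in>F3. complex_of_real (3 powr - (real n / 2)) * walsh n quartic_fun b = omega_pow (e :: 'a)"
    using d by (metis mult.assoc mult_1)
qed (rule quartic_fun_ternary)

text \<open>In F3-bases, \<open>x\<close> holds the coordinates in \<open>V\<close>, on which the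
  function is linear, and \<open>y\<close> those in \<open>U\<close>; the additive part g is
  zero.\<close>

lemma quartic_fun_maiorana_mcfarland:
  assumes "\<not> 4 dvd k"
  shows "quartic_fun \<in> maiorana_mcfarland k"
proof -
  obtain v where v: "\<And>i. i < k \<Longrightarrow> v i \<in> V" "bij_betw (F3_comb k v) (F3_vecs k) V"
    using F3_basis_exists[OF char3 eig_zero eig_add card_V] by blast
  obtain u where u: "bij_betw (F3_comb k u) (F3_vecs k) U"
    using F3_basis_exists[OF char3 eig_zero eig_add card_U] by blast
  define \<phi> where "\<phi> = (\<lambda>(x, y). - (F3_comb k u y + F3_comb k v x))"
  define h where "h y = a ^ 3 * F3_comb k u y ^ 5" for y
  \<comment> \<open>The coordinates of the functional t \<mapsto> -Tr(h(y) t) on the chosen basis of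
    \<open>V\<close>. Nondegeneracy on \<open>V\<close> recovers \<open>h y\<close> from them, and
    the fifth-power bijection recovers \<open>y\<close>.\<close>
  define \<pi> where "\<pi> y = vec k (\<lambda>i. - Tr n (h y * v i))" for y
  have U: "F3_comb k u y \<in> U" and V: "F3_comb k v y \<in> V" if "y \<in> F3_vecs k" for y
    using that u v(2) by (auto dest: bij_betwE)
  have "bij_betw (map_prod (F3_comb k v) (F3_comb k u)) (F3_vecs k \<times> F3_vecs k) (V \<times> U)"
    using v(2) u by (rule bij_betw_map_prod)
  then have "bij_betw ((\<lambda>(v, u). - (u + v)) \<circ> map_prod (F3_comb k v) (F3_comb k u))
      (F3_vecs k \<times> F3_vecs k) UNIV"
    using decomposition by (rule bij_betw_trans)
  also have "(\<lambda>(v, u). - (u + v)) \<circ> map_prod (F3_comb k v) (F3_comb k u) = \<phi>"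
    by (auto simp: \<phi>_def)
  finally have iso: "F3_pair_iso k \<phi>"
    by (auto simp: F3_pair_iso_def \<phi>_def F3_comb_add F3_comb_smult algebra_simps)
  have dot: "x \<bullet> \<pi> y = - Tr n (h y * F3_comb k v x)" if "x \<in> F3_vecs k" for x y
  proof -
    have "h y * F3_comb k v x = (\<Sum>i<k. x $ i * (h y * v i))"
      by (simp add: F3_comb_def sum_distrib_left mult_ac)
    also have "Tr n \<dots> = (\<Sum>i<k. x $ i * Tr n (h y * v i))"
      unfolding Tr_sum[OF char3]
      by (intro sum.cong) (use that in \<open>auto simp: F3_vecs_def Tr_smult[OF char3]\<close>)
    finally show ?thesis
      by (simp add: scalar_prod_def \<pi>_def sum_negf atLeast0LessThan)
  qed
  have bij: "bij_betw (\<lambda>u. a ^ 3 * u ^ 5) U W"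
    using bij_fifth_power[OF assms] .
  have "inj_on \<pi> (F3_vecs k)"
  proof (rule inj_onI)
    fix y y' :: "'a vec"
    assume y: "y \<in> F3_vecs k" "y' \<in> F3_vecs k" and eq: "\<pi> y = \<pi> y'"
    have hW: "h y \<in> W" "h y' \<in> W"
      using bij_betwE[OF bij] U y by (auto simp: h_def)
    have "Tr n ((h y - h y') * t) = 0" if "t \<in> V" for t
    proof -
      obtain x where "x \<in> F3_vecs k" "t = F3_comb k v x"
        using \<open>t \<in> V\<close> bij_betw_imp_surj_on[OF v(2)] by blast
      then show ?thesis
        using dot[of x y] dot[of x y'] eq by (simp add: left_diff_distrib Tr_diff[OF char3])
    qed
    moreover have "h y - h y' \<in> W"
      using eig_add[OF hW(1) eig_minus[OF hW(2)]] by simp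
    ultimately have "h y = h y'"
      using Tr_V_nondegenerate by fastforce
    then have "F3_comb k u y = F3_comb k u y'"
      unfolding h_def by (rule inj_onD[OF bij_betw_imp_inj_on[OF bij] _ U[OF y(1)] U[OF y(2)]])
    then show "y = y'"
      using inj_onD[OF bij_betw_imp_inj_on[OF u]] y by blast
  qed
  moreover have "\<pi> ` F3_vecs k \<subseteq> F3_vecs k"
    by (auto simp: \<pi>_def F3_vecs_def F3_minus[OF char3] Tr_in_F3[OF card])
  ultimately have "bij_betw \<pi> (F3_vecs k) (F3_vecs k)"
    unfolding bij_betw_def by (intro conjI endo_inj_surj finite_F3_vecs)
  moreover have "quartic_fun (\<phi> (x, y)) = x \<bullet> \<pi> y + 0" if "x \<in> F3_vecs k" "y \<in> F3_vecs k" for x y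
    unfolding \<phi>_def prod.case quartic_fun_decomposition[OF U[OF that(2)] V[OF that(1)]]
      dot[OF that(1)] h_def by simp
  moreover have "(\<lambda>_. 0 :: 'a) ` F3_vecs k \<subseteq> F3"
    by (auto simp: F3_def)
  ultimately show ?thesis
    unfolding maiorana_mcfarland_def using iso by blast
qed

end

subsection \<open>Algebraic degree and the completed class\<close>

text \<open>The i-th Frobenius conjugate shifts the ternary digits of 2 q + 4, q + 5 and 2
  cyclically by i places, so only digit sums 4, 4 and 2 occur. The exponent 2 q + 4 itself arises
  exactly once and keeps the coefficient \<open>a1\<close>, so nothing cancels there.\<close>

lemma algebraic_degree_quartic:
  fixes a1 a2 a3 :: "'a::{field,finite}"
  assumes card: "CARD('a) = 3 ^ n" and n: "n = 2 * k" and k: "k > 1" and a1: "a1 \<noteq> 0"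
  shows "algebraic_degree
    (\<lambda>x. Tr n (a1 * x ^ (2 * 3 ^ k + 4) + a2 * x ^ (3 ^ k + 5) + a3 * x\<^sup>2)) = 4"
    (is "algebraic_degree ?f = 4")
proof -
  note char3 = three_eq_0[OF card]
  \<comment> \<open>Digit strings: \<open>D p r s\<close> has a 2 at \<open>p\<close> and ones at
    \<open>r\<close> and \<open>s\<close>, provided these positions differ; \<open>D' p\<close> has
    only a 2 at \<open>p\<close>.\<close>
  define D :: "nat \<Rightarrow> nat \<Rightarrow> nat \<Rightarrow> nat \<Rightarrow> nat" where
    "D p r s j = (if j = p then 2 else 0) + (if j = r then 1 else 0) + (if j = s then 1 else 0)"
    for p r s j
  define D' :: "nat \<Rightarrow> nat \<Rightarrow> nat" where "D' p j = (if j = p then 2 else 0)" for p j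
  define ex :: "(nat \<Rightarrow> nat) \<Rightarrow> nat" where "ex d = (\<Sum>j<n. d j * 3 ^ j)" for d
  \<comment> \<open>Read off from 2 q + 4 = 2 q + 3 + 1 and q + 5 = q + 3 + 2, with all positions
    shifted by \<open>i\<close> modulo \<open>n\<close>.\<close>
  define d1 d2 d3 where "d1 i = D ((k + i) mod n) (Suc i mod n) i"
    and "d2 i = D i (Suc i mod n) ((k + i) mod n)" and "d3 i = D' i" for i
  have single: "(\<Sum>j<n. (if j = p then m else 0) * 3 ^ j) = m * 3 ^ p" if "p < n" for p m :: nat
  proof -
    have "(\<Sum>j<n. (if j = p then m else 0) * 3 ^ j) = (\<Sum>j<n. if j = p then m * 3 ^ p else 0)"
      by (intro sum.cong) auto
    then show ?thesis
      using that by simp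
  qed
  have ex_D: "ex (D p r s) = 2 * 3 ^ p + 3 ^ r + 3 ^ s" if "p < n" "r < n" "s < n" for p r s
    using that by (simp only: ex_def D_def add_mult_distrib sum.distrib single mult_1)
  have ex_D': "ex (D' p) = 2 * 3 ^ p" if "p < n" for p
    using that by (simp only: ex_def D'_def single)
  have mod: "(k + i) mod n = (if i < k then k + i else i - k)"
    "Suc i mod n = (if Suc i < n then Suc i else 0)" if "i < n" for i
    using that n by (auto simp: mod_if)
  \<comment> \<open>For k = 1 the first two positions would coincide; \<open>k > 1\<close> keeps all
    digits at most 2.\<close>
  have neq: "(k + i) mod n \<noteq> Suc i mod n" "(k + i) mod n \<noteq> i" "Suc i mod n \<noteq> i" if "i < n" for i
    unfolding mod[OF that] using that n k by auto
  have D_le: "D p r s j \<le> 2" if "p \<noteq> r" "p \<noteq> s" "r \<noteq> s" for p r s j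
    using that by (simp add: D_def)
  have le: "d1 i j \<le> 2" "d2 i j \<le> 2" "d3 i j \<le> 2" if "i < n" for i j
    using neq[OF that] by (auto simp: d1_def d2_def d3_def D'_def intro!: D_le)
  have digits: "ternary_digit_sum (ex (d1 i)) = 4" "ternary_digit_sum (ex (d2 i)) = 4"
    "ternary_digit_sum (ex (d3 i)) = 2" if "i < n" for i
  proof -
    have "n > 0"
      using n k by simp
    have "(\<Sum>j<n. D p r s j) = 4" if "p < n" "r < n" "s < n" for p r s
      using that by (simp add: D_def sum.distrib)
    moreover have "(\<Sum>j<n. D' p j) = 2" if "p < n" for p
      using that by (simp add: D'_def)
    ultimately show "ternary_digit_sum (ex (d1 i)) = 4" "ternary_digit_sum (ex (d2 i)) = 4"
      "ternary_digit_sum (ex (d3 i)) = 2"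
      using that \<open>n > 0\<close> le[OF that] unfolding ex_def
      by (simp_all add: ternary_digit_sum_expansion) (simp_all add: d1_def d2_def d3_def)
  qed
  have less: "ex (d1 i) < 3 ^ n" "ex (d2 i) < 3 ^ n" "ex (d3 i) < 3 ^ n" if "i < n" for i
    using ternary_expansion_less[OF le(1)[OF that]] ternary_expansion_less[OF le(2)[OF that]]
      ternary_expansion_less[OF le(3)[OF that]] by (simp_all add: ex_def)
  define p where "p = (\<Sum>i<n. monom (a1 ^ 3 ^ i) (ex (d1 i)) + monom (a2 ^ 3 ^ i) (ex (d2 i))
    + monom (a3 ^ 3 ^ i) (ex (d3 i)))"
  have coeff: "coeff p e = (\<Sum>i<n. (if ex (d1 i) = e then a1 ^ 3 ^ i else 0)
    + (if ex (d2 i) = e then a2 ^ 3 ^ i else 0) + (if ex (d3 i) = e then a3 ^ 3 ^ i else 0))" for e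
    by (simp add: p_def coeff_sum)
  have support: "\<exists>i<n. e \<in> {ex (d1 i), ex (d2 i), ex (d3 i)}" if "coeff p e \<noteq> 0" for e
  proof (rule ccontr)
    assume "\<not> ?thesis"
    then have "coeff p e = 0"
      unfolding coeff by (intro sum.neutral) auto
    then show False
      using that by simp
  qed
  have "degree p \<le> 3 ^ n - 1"
    using support less by (intro degree_le) fastforce
  moreover have "(3 :: nat) ^ n > 0"
    by simp
  ultimately have deg: "degree p < CARD('a)"
    unfolding card by linarith
  have "poly p x = ?f x" for x
  proof -
    \<comment> \<open>Reducing digit positions modulo \<open>n\<close> does not change the value of
      a monomial, so \<open>p\<close> induces the given function.\<close>
    have frob: "x ^ 3 ^ (m mod n) = x ^ 3 ^ m" for m
      using frobenius_mod[OF card, of x m] by simp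
    have "x ^ ex (d1 i) = (x ^ (2 * 3 ^ k + 4)) ^ 3 ^ i"
      "x ^ ex (d2 i) = (x ^ (3 ^ k + 5)) ^ 3 ^ i"
      "x ^ ex (d3 i) = (x\<^sup>2) ^ 3 ^ i" if "i < n" for i
    proof -
      have sq: "x ^ (2 * m) = x ^ m * x ^ m" for m
        by (simp add: mult_2 power_add)
      have "x ^ ex (d1 i) = x ^ (2 * 3 ^ (k + i) + 3 ^ Suc i + 3 ^ i)"
        using that by (simp only: d1_def ex_D mod_less_divisor power_add[of x] sq frob)
      also have "2 * 3 ^ (k + i) + 3 ^ Suc i + 3 ^ i = (2 * 3 ^ k + 4) * (3 :: nat) ^ i"
        by (simp add: algebra_simps power_add)
      finally show "x ^ ex (d1 i) = (x ^ (2 * 3 ^ k + 4)) ^ 3 ^ i"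
        by (simp only: power_mult)
      have "x ^ ex (d2 i) = x ^ (2 * 3 ^ i + 3 ^ Suc i + 3 ^ (k + i))"
        using that by (simp only: d2_def ex_D mod_less_divisor power_add[of x] sq frob)
      also have "2 * 3 ^ i + 3 ^ Suc i + 3 ^ (k + i) = (3 ^ k + 5) * (3 :: nat) ^ i"
        by (simp add: algebra_simps power_add)
      finally show "x ^ ex (d2 i) = (x ^ (3 ^ k + 5)) ^ 3 ^ i"
        by (simp only: power_mult)
      show "x ^ ex (d3 i) = (x\<^sup>2) ^ 3 ^ i"
        using that by (simp add: d3_def ex_D' power_mult)
    qed
    then show ?thesis
      by (simp add: p_def poly_sum poly_monom Tr_def frobenius_add[OF char3] power_mult_distrib)
  qed
  with deg have rep: "univariate_rep ?f = p"
    by (rule univariate_rep_eqI)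
  have uniq: "d j = d' j" if "ex d = ex d'" "\<And>j. d j \<le> 2" "\<And>j. d' j \<le> 2" "j < n" for d d' j
    using ternary_expansion_unique[of d d' n j] that by (simp add: ex_def)
  have "0 < n"
    using n k by simp
  \<comment> \<open>With \<open>r\<close> and \<open>s\<close> distinct the two ones cannot add up,
    so a digit 2 marks position \<open>p\<close>.\<close>
  have D_eq_2: "j = p" if "D p r s j = 2" "r \<noteq> s" for p r s j
    using that by (auto simp: D_def split: if_splits)
  have d1_0: "d1 0 = D k 1 0"
    using n k by (simp add: d1_def)
  have d1_0_k: "d1 0 k = 2"
    using k by (simp add: d1_0 D_def)
  have "k < n"
    using n k by simp
  have d1_inj: "i = 0" if "i < n" "ex (d1 i) = ex (d1 0)" for i
  proof -
    \<comment> \<open>The only digit 2 of the exponent 2 q + 4 is at \<open>k\<close>; in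
      \<open>d1 i\<close> it is at \<open>k + i\<close> modulo \<open>n\<close>.\<close>
    have "d1 i k = 2"
      using uniq[OF that(2)] le \<open>i < n\<close> \<open>0 < n\<close> \<open>k < n\<close> d1_0_k by simp
    then have "k = (k + i) mod n"
      unfolding d1_def using D_eq_2 neq(3)[OF that(1)] by blast
    then have "k = (if i < k then k + i else i - k)"
      unfolding mod(1)[OF that(1)] .
    then show ?thesis
      using that(1) n k by (auto split: if_splits)
  qed
  have d2_neq: "ex (d2 i) \<noteq> ex (d1 0)" if "i < n" for i
  proof
    assume eq: "ex (d2 i) = ex (d1 0)"
    have d2: "d2 i j = d1 0 j" if "j < n" for j
      using uniq[OF eq] le \<open>i < n\<close> \<open>0 < n\<close> that by simp
    have "d2 i k = 2"
      using d2[OF \<open>k < n\<close>] d1_0_k by simp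
    then have "k = i"
      unfolding d2_def using D_eq_2 neq(1)[OF that] by metis
    \<comment> \<open>Once the digits 2 are aligned, \<open>d2 k\<close> has a one at
      \<open>k + 1\<close>, where \<open>d1 0\<close> has a zero.\<close>
    then have "d2 i (Suc k) = D k (Suc k) 0 (Suc k)"
      using n k by (simp add: d2_def flip: mult_2)
    moreover have "d2 i (Suc k) = D k 1 0 (Suc k)"
      using d2[of "Suc k"] n k by (simp add: d1_0)
    ultimately show False
      using k by (simp add: D_def)
  qed
  have d3_neq: "ex (d3 i) \<noteq> ex (d1 0)" if "i < n" for i
    using digits[OF that] digits[OF \<open>0 < n\<close>] by auto
  have "coeff p (ex (d1 0)) = (\<Sum>i<n. if i = 0 then a1 else 0)"
    unfolding coeff using d1_inj d2_neq d3_neq by (intro sum.cong) auto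
  then have "coeff p (ex (d1 0)) \<noteq> 0"
    using a1 \<open>0 < n\<close> by simp
  moreover have "finite {e. coeff p e \<noteq> 0}"
    by (rule finite_subset[of _ "{..degree p}"]) (auto intro: le_degree)
  ultimately show ?thesis
    unfolding algebraic_degree_def rep
  proof (intro Max_eqI)
    fix y
    assume "y \<in> insert 0 (ternary_digit_sum ` {e. coeff p e \<noteq> 0})"
    then consider "y = 0" | e where "coeff p e \<noteq> 0" "y = ternary_digit_sum e"
      by blast
    then show "y \<le> 4"
    proof cases
      case 2
      then show ?thesis
        using support[of e] digits by auto
    qed simp
  next
    assume "coeff p (ex (d1 0)) \<noteq> 0"
    then show "4 \<in> insert 0 (ternary_digit_sum ` {e. coeff p e \<noteq> 0})"
      using digits(1)[OF \<open>0 < n\<close>] by (intro insertI2 image_eqI[of _ _ "ex (d1 0)"]) auto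
  qed simp
qed

text \<open>Reflexivity of EA-equivalence, by a = 1, L the identity and l = 0: the class of
  \<open>f\<close> contains \<open>f\<close> and hence meets \<open>C\<close>.\<close>

lemma mem_completed_class:
  fixes f :: "'a::field \<Rightarrow> 'a"
  assumes "f \<in> C" "f \<in> ternary_functions"
  shows "f \<in> completed_class C"
proof -
  have "F3_affine (id :: 'a \<Rightarrow> 'a)"
    unfolding F3_affine_def by (intro exI[of _ id] exI[of _ 0]) (auto simp: F3_linear_def)
  moreover have "F3_affine (\<lambda>_. 0 :: 'a)"
    unfolding F3_affine_def by (intro exI[of _ "\<lambda>_. 0"] exI[of _ 0]) (auto simp: F3_linear_def)
  moreover have "(\<lambda>_. 0 :: 'a) \<in> ternary_functions"
    by (auto simp: ternary_functions_def F3_def)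
  ultimately have "\<exists>L l. F3_affine L \<and> bij L \<and> F3_affine l \<and> l \<in> ternary_functions \<and>
      f = (\<lambda>x. 1 * f (L x) + l x)"
    by (intro exI[of _ id] exI[of _ "\<lambda>_. 0"]) auto
  moreover have "(1 :: 'a) \<in> F3 - {0}"
    by (auto simp: F3_def)
  ultimately have "(f, f) \<in> EA_rel"
    unfolding EA_rel_def using assms(2) by blast
  then have "f \<in> EA_rel `` {f}" "EA_rel `` {f} \<in> ternary_functions // EA_rel"
    using assms(2) by (auto intro: quotientI)
  then show ?thesis
    unfolding completed_class_def using assms(1) by blast
qed

subsection \<open>The two families of coefficients\<close>

text \<open>The power is a square root of 1. If it were 1, the powers of \<alpha> would take at most
  \<open>M\<close> values, fewer than the 2 M nonzero elements.\<close>

lemma primitive_element_half_order: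
  fixes \<alpha> :: "'a::{field,finite}"
  assumes \<alpha>: "primitive_element \<alpha>" and card: "CARD('a) = 2 * M + 1" and "M > 0"
  shows "\<alpha> ^ M = -1"
proof -
  have range: "range (\<lambda>i. \<alpha> ^ i) = UNIV - {0}"
    using \<alpha> by (simp add: primitive_element_def)
  have "\<alpha> ^ 1 \<noteq> 0"
    using range by blast
  moreover have "\<alpha> * \<alpha> ^ (2 * M) = \<alpha>"
    using power_card_eq_same[of \<alpha>] by (simp add: card)
  ultimately have "\<alpha> ^ (2 * M) = 1"
    by simp
  then have "(\<alpha> ^ M)\<^sup>2 = 1"
    by (simp add: mult.commute flip: power_mult)
  moreover have "\<alpha> ^ M \<noteq> 1"
  proof
    assume one: "\<alpha> ^ M = 1"
    have "\<alpha> ^ i = \<alpha> ^ (i mod M)" for i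
    proof -
      have "\<alpha> ^ i = \<alpha> ^ (M * (i div M) + i mod M)"
        by simp
      also have "\<dots> = \<alpha> ^ (i mod M)"
        unfolding power_add power_mult one by simp
      finally show ?thesis .
    qed
    moreover have "i mod M \<in> {..<M}" for i
      using \<open>M > 0\<close> by simp
    ultimately have "range (\<lambda>i. \<alpha> ^ i) \<subseteq> (\<lambda>i. \<alpha> ^ i) ` {..<M}"
      by (intro image_subsetI) (metis image_eqI)
    then have "card (UNIV - {0 :: 'a}) \<le> card ((\<lambda>i. \<alpha> ^ i) ` {..<M})"
      unfolding range by (intro card_mono) auto
    also have "\<dots> \<le> M"
      using card_image_le[of "{..<M}"] by simp
    finally show False
      using card \<open>M > 0\<close> by (simp add: card_Diff_singleton)
  qed
  ultimately show ?thesis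
    by (simp add: power2_eq_1_iff)
qed

lemma primitive_fourth_root_square:
  assumes "primitive_root_of_unity 4 (I :: 'a::field)"
  shows "I\<^sup>2 = -1"
proof -
  have "(I\<^sup>2)\<^sup>2 = 1" "I\<^sup>2 \<noteq> 1"
    using assms by (auto simp: primitive_root_of_unity_def simp flip: power_mult)
  then show ?thesis
    by (simp only: power2_eq_1_iff) simp
qed

text \<open>Gives the parity of (q + 1)/2, on which c^(q+1) = 1 rests: even for odd
  \<open>k\<close>, odd for even \<open>k\<close>.\<close>

lemma power_3_mod_4: "(3 :: nat) ^ k mod 4 = (if even k then 1 else 3)"
proof (induction k)
  case (Suc k)
  have "(3 :: nat) ^ Suc k mod 4 = 3 * (3 ^ k mod 4) mod 4"
    by (simp add: mod_mult_right_eq)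
  then show ?case
    unfolding Suc by simp
qed simp

theorem theorem4:
  fixes n k :: nat
    and \<alpha> I s a1 a2 a3 :: "'a::{field,finite}"
    and f :: "'a \<Rightarrow> 'a"
  assumes card: "CARD('a) = 3 ^ n"
    and n: "n = 2 * k" and k: "k > 1" "\<not> 4 dvd k"
    and \<alpha>: "primitive_element \<alpha>"
    and I: "primitive_root_of_unity 4 I"
    and sign: "s = 1 \<or> s = -1"
    and odd: "odd k \<Longrightarrow> a1 = 1 \<and> a3 = 1 \<and> a2 = s * I"
    and even: "even k \<Longrightarrow> a1 = \<alpha> ^ (3 ^ k + 2) \<and> a3 = \<alpha> \<and>
                 a2 = s * I * a1 powi (- ((3 ^ k - 3) div 2))"
    and f: "f = (\<lambda>x. Tr n (a1 * x ^ (2 * 3 ^ k + 4) + a2 * x ^ (3 ^ k + 5) + a3 * x ^ 2))"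
  shows "(even k \<longrightarrow> a2 = - s * I * a3 ^ ((3 ^ k + 5) div 2)) \<and>
         regular_bent n f \<and>
         algebraic_degree f = 4 \<and>
         f \<in> completed_class (maiorana_mcfarland k)"
proof -
  have sI: "(s * I)\<^sup>2 = -1"
    using sign primitive_fourth_root_square[OF I] by (auto simp: power_mult_distrib)
  have "odd ((3 :: nat) ^ k)"
    by simp
  then obtain r where r: "(3 :: nat) ^ k = 2 * r + 1"
    by (rule oddE)
  moreover have "(3 :: nat) ^ k \<ge> 3 ^ 1"
    using k by (intro power_increasing) auto
  ultimately have "(3 :: nat) ^ k = 2 * (r - 1) + 3"
    by simp
  \<comment> \<open>\<open>m\<close> is (q - 3)/2, so q - 1 = 2 m + 2, q + 1 = 2 (m + 2) and (q +
    5)/2 = m + 4; all exponents become polynomials in \<open>m\<close>.\<close>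
  then obtain m where m: "(3 :: nat) ^ k = 2 * m + 3"
    by blast
  have "(3 :: nat) ^ n = (3 ^ k)\<^sup>2"
    by (simp add: n power2_eq_square power_add mult_2)
  then have card_m: "CARD('a) = 2 * ((2 * m + 2) * (m + 2)) + 1"
    unfolding card m by (simp add: algebra_simps power2_eq_square)
  have half: "\<alpha> ^ ((2 * m + 2) * (m + 2)) = -1"
    using primitive_element_half_order[OF \<alpha> card_m] by simp
  then have "\<alpha> \<noteq> 0"
    by (auto simp: power_0_left)
  have a2_even: "a2 = - s * I * a3 ^ ((3 ^ k + 5) div 2)" if "even k"
  proof -
    have "(3 :: int) ^ k = int (3 ^ k)"
      by simp
    also have "\<dots> = 2 * int m + 3"
      unfolding m by simp
    finally have "((3 :: int) ^ k - 3) div 2 = int m"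
      by simp
    then have "a2 = s * I * inverse (\<alpha> ^ ((2 * m + 5) * m))"
      using even[OF that] by (simp add: m power_int_minus power_mult add.commute)
    \<comment> \<open>The exponents add up to (q^2 - 1)/2, where the power of \<alpha> is -1. This
      turns the inverse into a positive power and accounts for the opposite sign in the second
      formula for \<open>a2\<close>.\<close>
    moreover have "\<alpha> ^ ((2 * m + 5) * m) * \<alpha> ^ (m + 4) = -1"
      unfolding half[symmetric] power_add[symmetric]
      by (rule arg_cong[where f = "power \<alpha>"]) (simp add: algebra_simps)
    then have "inverse (\<alpha> ^ ((2 * m + 5) * m)) = - (\<alpha> ^ (m + 4))"
      by (intro inverse_unique) simp
    moreover have "(3 ^ k + 5) div 2 = m + 4"
      unfolding m by simp
    ultimately show ?thesis
      using even[OF that] by simp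
  qed
  obtain a c where c: "a1 = a ^ (3 ^ k + 2)" "a2 = c * a ^ 3" "a3 = a" "a \<noteq> 0"
    "c ^ (3 ^ k + 1) = 1" "c\<^sup>2 = - (a ^ (3 ^ k - 1))"
  proof (cases "even k")
    case False
    have "4 dvd (3 :: nat) ^ k + 1"
      using power_3_mod_4[of k] False by presburger
    then obtain j where j: "(3 :: nat) ^ k + 1 = 4 * j"
      by blast
    have "(s * I) ^ 4 = ((s * I)\<^sup>2)\<^sup>2"
      by (simp flip: power_mult)
    then have "(s * I) ^ (3 ^ k + 1) = 1"
      unfolding j power_mult sI by simp
    then show ?thesis
      using that[of 1 "s * I"] odd False sI by simp
  next
    case True
    \<comment> \<open>Forced by \<open>a2 = c * \<alpha> ^ 3\<close>: the exponent is (q + 5)/2 -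
      3.\<close>
    define c where "c = - s * I * \<alpha> ^ (m + 1)"
    have c2: "c\<^sup>2 = - (\<alpha> ^ (2 * m + 2))"
    proof -
      have "c\<^sup>2 = (s * I)\<^sup>2 * (\<alpha> ^ (m + 1))\<^sup>2"
        by (simp add: c_def power_mult_distrib)
      also have "(\<alpha> ^ (m + 1))\<^sup>2 = \<alpha> ^ (2 * m + 2)"
        unfolding power_mult[symmetric] by (rule arg_cong[where f = "power \<alpha>"]) simp
      finally show ?thesis
        by (simp add: sI)
    qed
    have "odd (m + 2)"
      using power_3_mod_4[of k] True unfolding m by presburger
    have "c ^ (3 ^ k + 1) = c ^ (2 * (m + 2))"
      unfolding m by (rule arg_cong[where f = "power c"]) simp
    \<comment> \<open>The odd exponent \<open>m + 2\<close> pulls out a minus sign, which cancels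
      against \<alpha>^((q^2-1)/2) = -1.\<close>
    also have "\<dots> = (- (\<alpha> ^ (2 * m + 2))) ^ (m + 2)"
      unfolding power_mult c2 ..
    also have "\<dots> = 1"
      unfolding power_minus_odd[OF \<open>odd (m + 2)\<close>] power_mult[symmetric] half by simp
    finally have "c ^ (3 ^ k + 1) = 1" .
    moreover have "a2 = c * \<alpha> ^ 3"
    proof -
      have "(3 ^ k + 5) div 2 = m + 1 + 3"
        unfolding m by simp
      then show ?thesis
        using a2_even[OF True] even[OF True] by (simp only: c_def power_add mult.assoc)
    qed
    moreover have "c\<^sup>2 = - (\<alpha> ^ (3 ^ k - 1))"
      unfolding c2 m by simp
    ultimately show ?thesis
      using that[of \<alpha> c] even[OF True] \<open>\<alpha> \<noteq> 0\<close> by blast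
  qed
  interpret Q: quartic n k a c
    by unfold_locales (use card n k c in auto)
  have f_eq: "f = Q.quartic_fun"
    unfolding f Q.quartic_fun_def c ..
  have "algebraic_degree f = 4"
    unfolding f using card n k(1) by (rule algebraic_degree_quartic) (simp add: c)
  moreover have "f \<in> completed_class (maiorana_mcfarland k)"
    unfolding f_eq
    by (rule mem_completed_class[OF Q.quartic_fun_maiorana_mcfarland[OF k(2)] Q.quartic_fun_ternary])
  ultimately show ?thesis
    using a2_even Q.regular_bent_quartic_fun[OF k(2)] f_eq by blast
qed

end
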